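(* There exists a graded $\mathfrak m$-primary family on a one-dimensional regular local ring $(R,\mathfrak m)$ which admits a weak asymptotic joint reduction of type $1$ but no strong homogeneous joint reduction of type $1$.
   Context: A graded $\mathfrak m$-primary family is a family $\mathcal I=\{I_n\}_{n\ge0}$ of ideals with $I_0=R$, $I_n$ $\mathfrak m$-primary for $n>0$, and $I_mI_n\subseteq I_{m+n}$ for all $m,n$. For a single family $\mathcal I=\{I_n\}$ (i.e. $s=1$) and type $1$: a weak asymptotic joint reduction of type $1$ is a sequence of elements $x^{(n)}\in I_n$, $n\ge n_0$ (for some $n_0$), such that for every $n\ge n_0$ the ideal $(x^{(n)})$ is a reduction of $I_n$, i.e. $x^{(n)}I_n^r=I_n^{r+1}$ for some $r\ge0$. A strong homogeneous joint reduction of type $1$ consists of a positive integer $a$ and an element $x\in I_a$ such that $I_n=xI_{n-a}$ for all sufficiently large $n$. *)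

theory Defs
  imports
    "HOL-Algebra.Algebra"
    "HOL-Library.Extended_Nat"
    "HOL-Computational_Algebra.Formal_Power_Series"
begin

locale local_ring = cring R for R (structure) +
  fixes \<mm> :: "'a set"
  assumes maximal: "maximalideal \<mm> R"
    and unique: "maximalideal M R \<Longrightarrow> M = \<mm>"

definition krull_dim :: "('a, 'b) ring_scheme \<Rightarrow> enat" where
  "krull_dim R = Sup {enat n | n. \<exists>P :: nat \<Rightarrow> 'a set.
     (\<forall>i\<le>n. primeideal (P i) R) \<and> (\<forall>i<n. P i \<subset> P (Suc i))}"

text \<open>Only meaningful for finitely generated ideals: otherwise the \<open>LEAST\<close> is unspecified.\<close>
definition min_generators :: "('a, 'b) ring_scheme \<Rightarrow> 'a set \<Rightarrow> nat" where
  "min_generators R I =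
     (LEAST n. \<exists>A \<subseteq> carrier R. finite A \<and> card A = n \<and> I = genideal R A)"

locale regular_local_ring = local_ring R \<mm> + noetherian_ring R
  for R (structure) and \<mm> +
  assumes regular: "enat (min_generators R \<mm>) = krull_dim R"

definition ideal_radical :: "('a, 'b) ring_scheme \<Rightarrow> 'a set \<Rightarrow> 'a set" where
  "ideal_radical R Q = {x \<in> carrier R. \<exists>n::nat. x [^]\<^bsub>R\<^esub> n \<in> Q}"

definition primary_ideal :: "('a, 'b) ring_scheme \<Rightarrow> 'a set \<Rightarrow> bool" where
  "primary_ideal R Q \<longleftrightarrow> ideal Q R \<and> Q \<noteq> carrier R \<and>
     (\<forall>x \<in> carrier R. \<forall>y \<in> carrier R.
        x \<otimes>\<^bsub>R\<^esub> y \<in> Q \<longrightarrow> x \<in> Q \<or> (\<exists>n::nat. y [^]\<^bsub>R\<^esub> n \<in> Q))"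

definition primary_to :: "('a, 'b) ring_scheme \<Rightarrow> 'a set \<Rightarrow> 'a set \<Rightarrow> bool" where
  "primary_to R \<mm> Q \<longleftrightarrow> primary_ideal R Q \<and> ideal_radical R Q = \<mm>"

definition graded_primary_family ::
  "('a, 'b) ring_scheme \<Rightarrow> 'a set \<Rightarrow> (nat \<Rightarrow> 'a set) \<Rightarrow> bool" where
  "graded_primary_family R \<mm> I \<longleftrightarrow>
     I 0 = carrier R \<and>
     (\<forall>n>0. primary_to R \<mm> (I n)) \<and>
     (\<forall>m n. I m \<cdot>\<^bsub>R\<^esub> I n \<subseteq> I (m + n))"

text \<open>Powers of ideals are powers in the monoid \<open>ideals_set R\<close>, so \<open>I\<^sup>0 = R\<close>.\<close>
definition is_reduction :: "('a, 'b) ring_scheme \<Rightarrow> 'a set \<Rightarrow> 'a set \<Rightarrow> bool" where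
  "is_reduction R J I \<longleftrightarrow> ideal J R \<and> ideal I R \<and> J \<subseteq> I \<and>
     (\<exists>r::nat. J \<cdot>\<^bsub>R\<^esub> (I [^]\<^bsub>ideals_set R\<^esub> r) = I [^]\<^bsub>ideals_set R\<^esub> (Suc r))"

definition weak_asymptotic_joint_reduction ::
  "('a, 'b) ring_scheme \<Rightarrow> (nat \<Rightarrow> 'a set) \<Rightarrow> nat \<Rightarrow> (nat \<Rightarrow> 'a) \<Rightarrow> bool" where
  "weak_asymptotic_joint_reduction R I n\<^sub>0 x \<longleftrightarrow>
     (\<forall>n\<ge>n\<^sub>0. x n \<in> I n \<and> is_reduction R (cgenideal R (x n)) (I n))"

text \<open>The bound \<open>N \<ge> a\<close> keeps the subtraction \<open>n - a\<close> from being truncated;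
  the product of an element \<open>x\<close> with an ideal is the product with the principal ideal of \<open>x\<close>.\<close>
definition strong_homogeneous_joint_reduction ::
  "('a, 'b) ring_scheme \<Rightarrow> (nat \<Rightarrow> 'a set) \<Rightarrow> nat \<Rightarrow> 'a \<Rightarrow> bool" where
  "strong_homogeneous_joint_reduction R I a x \<longleftrightarrow> a > 0 \<and> x \<in> I a \<and>
     (\<exists>N\<ge>a. \<forall>n\<ge>N. I n = cgenideal R x \<cdot>\<^bsub>R\<^esub> I (n - a))"

text \<open>HOL cannot quantify existentially over carrier types, so existence statements
  about rings need a fixed type to carry the witness. Only the elements are restricted by this
  type: the carrier set and the operations remain arbitrary.\<close>
type_synonym witness = "rat fps"

end

(* In the discrete valuation ring K[[X]] take I_n = (X^(n+1)) for n > 0. Every I_n is principal, so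
   its generator is a reduction of it. But ord I_n = n + 1 is a linear function with a positive
   constant term: any x in I_a has order at least a + 1, so x I_(n-a) has order at least n + 2 and
   cannot be I_n. *)

theory Submission
  imports Defs
begin

section \<open>Formal power series over a field as a ring structure, and its ideals\<close>

definition fps_ring :: "'a::field fps ring" where
  "fps_ring = \<lparr>carrier = UNIV, monoid.mult = (*), one = 1, ring.zero = 0, add = (+)\<rparr>"

lemma fps_ring_simps [simp]:
  "carrier fps_ring = UNIV" "x \<otimes>\<^bsub>fps_ring\<^esub> y = x * y" "\<one>\<^bsub>fps_ring\<^esub> = 1"
  "\<zero>\<^bsub>fps_ring\<^esub> = 0" "x \<oplus>\<^bsub>fps_ring\<^esub> y = x + y"
  by (simp_all add: fps_ring_def)

lemma fps_ring_pow [simp]: "x [^]\<^bsub>fps_ring\<^esub> (n::nat) = x ^ n"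
  by (induction n) (simp_all add: nat_pow_def mult.commute)

lemma cring_fps_ring: "cring fps_ring"
proof (intro cringI abelian_groupI comm_monoidI)
  fix x :: "'a fps"
  assume "x \<in> carrier fps_ring"
  show "\<exists>y\<in>carrier fps_ring. y \<oplus>\<^bsub>fps_ring\<^esub> x = \<zero>\<^bsub>fps_ring\<^esub>"
    by (rule bexI[of _ "- x"]) simp_all
qed (simp_all add: algebra_simps)

interpretation fps: cring fps_ring
  by (rule cring_fps_ring)

text \<open>The ideal generated by X^n, encoded by divisibility so that membership questions become
  statements about \<open>dvd\<close> and orders. \<open>cgenideal_fps_X_power\<close> makes the
  link with principal ideals.\<close>

definition fps_ideal :: "nat \<Rightarrow> 'a::field fps set" where
  "fps_ideal n = {f. fps_X ^ n dvd f}"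

lemma mem_fps_ideal: "f \<in> fps_ideal n \<longleftrightarrow> fps_X ^ n dvd f"
  by (simp add: fps_ideal_def)

lemma fps_X_dvd_iff: "fps_X dvd f \<longleftrightarrow> fps_nth f 0 = 0" for f :: "'a::field fps"
  by (cases "f = 0") (simp_all add: fps_dvd_iff Suc_le_eq zero_less_iff_neq_zero subdegree_eq_0_iff)

lemma fps_ideal_1: "f \<in> fps_ideal (Suc 0) \<longleftrightarrow> fps_nth f 0 = 0"
  by (simp add: mem_fps_ideal fps_X_dvd_iff)

lemma fps_ideal_0: "fps_ideal 0 = UNIV"
  by (auto simp: mem_fps_ideal)

lemma cgenideal_fps_X_power: "PIdl\<^bsub>fps_ring\<^esub> (fps_X ^ n) = fps_ideal n"
  by (auto simp: cgenideal_def fps_ideal_def dvd_def mult.commute)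

lemma ideal_fps_ideal: "ideal (fps_ideal n) fps_ring"
  using fps.cgenideal_ideal[of "fps_X ^ n"] by (simp add: cgenideal_fps_X_power)

lemma genideal_fps_X_power: "Idl\<^bsub>fps_ring\<^esub> {fps_X ^ n} = (fps_ideal n :: 'a::field fps set)"
  using fps.cgenideal_eq_genideal[of "fps_X ^ n :: 'a fps"] by (simp add: cgenideal_fps_X_power)

lemma fps_X_power_in_fps_ideal_iff: "(fps_X ^ m :: 'a::field fps) \<in> fps_ideal n \<longleftrightarrow> n \<le> m"
  by (simp add: mem_fps_ideal fps_dvd_iff)

lemma fps_ideal_inject: "fps_ideal m = (fps_ideal n :: 'a::field fps set) \<longleftrightarrow> m = n"
  by (metis fps_X_power_in_fps_ideal_iff le_antisym order_refl)

text \<open>A nonzero ideal contains an element f of least order n. Over a field, f divides every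
  series of order at least n, so the ideal is exactly (X^n). The prime ideals, the maximal ideals
  and the Noetherian property are all read off from this classification.\<close>

lemma fps_ideal_cases:
  assumes "ideal I (fps_ring :: 'a::field fps ring)"
  obtains "I = {0}" | n where "I = fps_ideal n"
proof (cases "I \<subseteq> {0}")
  case True
  moreover have "0 \<in> I"
    using additive_subgroup.zero_closed[OF ideal.axioms(1)[OF assms]] by simp
  ultimately show ?thesis
    using that(1) by blast
next
  case False
  then have "\<exists>f. f \<in> I \<and> f \<noteq> 0"
    by blast
  from ex_has_least_nat[of "\<lambda>f. f \<in> I \<and> f \<noteq> 0" _ subdegree] this
  obtain f where f: "f \<in> I" "f \<noteq> 0"
    and least: "\<And>g. g \<in> I \<Longrightarrow> g \<noteq> 0 \<Longrightarrow> subdegree f \<le> subdegree g"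
    by blast
  have "I = fps_ideal (subdegree f)"
  proof
    show "I \<subseteq> fps_ideal (subdegree f)"
    proof
      fix g assume "g \<in> I"
      then show "g \<in> fps_ideal (subdegree f)"
        using least[of g] by (cases "g = 0") (simp_all add: mem_fps_ideal fps_dvd_iff)
    qed
    show "fps_ideal (subdegree f) \<subseteq> I"
    proof
      fix g :: "'a fps" assume "g \<in> fps_ideal (subdegree f)"
      then have "f dvd g"
        using f(2) by (cases "g = 0") (simp_all add: mem_fps_ideal fps_dvd_iff)
      then obtain h where "g = f * h" ..
      then show "g \<in> I"
        using ideal.I_r_closed[OF assms f(1), of h] by simp
    qed
  qed
  then show ?thesis
    by (rule that(2))
qed

section \<open>Prime ideals, Krull dimension and regularity\<close>

lemma primeideal_zero_fps: "primeideal {0} (fps_ring :: 'a::field fps ring)"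
proof (rule primeidealI)
  show "carrier fps_ring \<noteq> ({0} :: 'a fps set)"
    using one_neq_zero[where 'a = "'a fps"] by (metis UNIV_I fps_ring_simps(1) singletonD)
qed (use fps.zeroideal fps.cring_axioms in auto)

text \<open>Lying in (X) means having constant coefficient 0, and constant coefficients multiply in
  a field.\<close>

lemma primeideal_fps_ideal_1: "primeideal (fps_ideal 1) (fps_ring :: 'a::field fps ring)"
proof (rule primeidealI)
  show "carrier fps_ring \<noteq> (fps_ideal 1 :: 'a fps set)"
    using fps_ideal_inject[of 0 1] by (simp add: fps_ideal_0)
qed (use ideal_fps_ideal fps.cring_axioms in \<open>auto simp: fps_ideal_1\<close>)

text \<open>For n = 0 the ideal (X^n) is the whole ring. For n \<ge> 2 it contains the product of X
  and X^(n-1) but neither factor.\<close>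

lemma primeideal_fps_cases:
  assumes "primeideal P (fps_ring :: 'a::field fps ring)"
  shows "P = {0} \<or> P = fps_ideal 1"
proof (rule fps_ideal_cases[OF primeideal.axioms(1)[OF assms]])
  fix n assume P: "P = fps_ideal n"
  have "n \<noteq> 0"
    using primeideal.I_notcarr[OF assms] P by (auto simp: fps_ideal_0)
  moreover have "\<not> n \<ge> 2"
  proof
    assume n: "n \<ge> 2"
    have "fps_X * fps_X ^ (n - 1) = (fps_X ^ n :: 'a fps)"
      using n by (simp flip: power_Suc)
    then have "(fps_X :: 'a fps) \<in> P \<or> (fps_X :: 'a fps) ^ (n - 1) \<in> P"
      using primeideal.I_prime[OF assms, of fps_X "fps_X ^ (n - 1)"]
      by (simp add: P fps_X_power_in_fps_ideal_iff)
    then show False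
      using n fps_X_power_in_fps_ideal_iff[of 1 n, where 'a = 'a]
        fps_X_power_in_fps_ideal_iff[of "n - 1" n, where 'a = 'a] by (auto simp: P)
  qed
  ultimately have "n = 1"
    by linarith
  then show ?thesis
    using P by simp
qed simp

lemma krull_dim_fps_ring: "krull_dim (fps_ring :: 'a::field fps ring) = 1"
proof -
  have "fps_X \<in> (fps_ideal 1 :: 'a fps set)"
    by (simp add: fps_ideal_1)
  then have "{0} \<noteq> (fps_ideal 1 :: 'a fps set)"
    using fps_X_neq_zero by blast
  then have zero_less: "{0} \<subset> (fps_ideal 1 :: 'a fps set)"
    by (auto simp: fps_ideal_1)
  show ?thesis
    unfolding krull_dim_def
  proof (rule antisym[OF Sup_least Sup_upper], safe)
    fix n :: nat and P :: "nat \<Rightarrow> 'a fps set"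
    assume P: "\<forall>i\<le>n. primeideal (P i) fps_ring" "\<forall>i<n. P i \<subset> P (Suc i)"
    show "enat n \<le> 1"
    proof (rule ccontr)
      assume "\<not> enat n \<le> 1"
      then have n: "2 \<le> n"
        by (simp add: one_enat_def)
      \<comment> \<open>A longer chain would begin with three strictly increasing primes, but only
        two primes are available.\<close>
      have "P 0 \<subset> P 1" "P 1 \<subset> P 2"
        using P(2) n by (simp_all add: numeral_2_eq_2)
      moreover have "P i = {0} \<or> P i = fps_ideal 1" if "i \<le> 2" for i
        using primeideal_fps_cases P(1) n that le_trans by blast
      from this[of 0] this[of 1] this[of 2]
      have "P 0 = {0} \<or> P 0 = fps_ideal 1" "P 1 = {0} \<or> P 1 = fps_ideal 1"
        "P 2 = {0} \<or> P 2 = fps_ideal 1"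
        by simp_all
      ultimately show False
        using zero_less by auto
    qed
  next
    \<comment> \<open>The chain from {0} to (X) attains the bound. Chains are functions on all of
      \<open>nat\<close>; the values beyond index 1 are unconstrained.\<close>
    let ?P = "\<lambda>i::nat. if i = 0 then {0} else fps_ideal 1 :: 'a fps set"
    have "(\<forall>i\<le>1. primeideal (?P i) fps_ring) \<and> (\<forall>i<1. ?P i \<subset> ?P (Suc i))"
      using primeideal_zero_fps[where 'a = 'a] primeideal_fps_ideal_1[where 'a = 'a] zero_less by simp
    then show "\<exists>n. 1 = enat n \<and> (\<exists>P :: nat \<Rightarrow> 'a fps set.
        (\<forall>i\<le>n. primeideal (P i) fps_ring) \<and> (\<forall>i<n. P i \<subset> P (Suc i)))"
      by (intro exI[of _ "1::nat"] conjI[OF one_enat_def] exI[of _ ?P])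
  qed
qed

text \<open>X^n alone generates the ideal, whereas the empty set generates only {0}, which misses
  X^n.\<close>

lemma min_generators_fps_ideal: "min_generators fps_ring (fps_ideal n :: 'a::field fps set) = 1"
  unfolding min_generators_def
proof (rule Least_equality)
  show "\<exists>A\<subseteq>carrier fps_ring. finite A \<and> card A = 1 \<and> (fps_ideal n :: 'a fps set) = Idl\<^bsub>fps_ring\<^esub> A"
    by (rule exI[of _ "{fps_X ^ n}"]) (simp add: genideal_fps_X_power)
next
  fix k
  assume "\<exists>A\<subseteq>carrier fps_ring. finite A \<and> card A = k \<and> (fps_ideal n :: 'a fps set) = Idl\<^bsub>fps_ring\<^esub> A"
  then obtain A :: "'a fps set" where A: "finite A" "card A = k" "fps_ideal n = Idl\<^bsub>fps_ring\<^esub> A"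
    by blast
  show "1 \<le> k"
  proof (rule ccontr)
    assume "\<not> 1 \<le> k"
    with A(1,2) have "A = {}"
      by (simp add: not_less_eq_eq)
    with A(3) have "fps_ideal n = Idl\<^bsub>fps_ring\<^esub> ({} :: 'a fps set)"
      by simp
    also have "\<dots> \<subseteq> {0}"
      using fps.genideal_minimal[OF fps.zeroideal, of "{}"] by simp
    finally show False
      using fps_X_power_in_fps_ideal_iff[of n n, where 'a = 'a] by auto
  qed
qed

text \<open>An ideal that contains X is nonzero, hence of the form (X^n), and X can lie in it only
  if n \<le> 1.\<close>

lemma maximalideal_fps_ideal_1: "maximalideal (fps_ideal 1) (fps_ring :: 'a::field fps ring)"
proof (rule maximalidealI)
  show "carrier fps_ring \<noteq> (fps_ideal 1 :: 'a fps set)"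
    using fps_ideal_inject[of 0 1] by (simp add: fps_ideal_0)
next
  fix J :: "'a fps set"
  assume J: "ideal J fps_ring" "fps_ideal 1 \<subseteq> J"
  have X: "fps_X ^ 1 \<in> J"
    using J(2) fps_X_power_in_fps_ideal_iff[of 1 1, where 'a = 'a] by blast
  show "J = fps_ideal 1 \<or> J = carrier fps_ring"
  proof (rule fps_ideal_cases[OF J(1)])
    fix n assume "J = fps_ideal n"
    moreover from this have "n = 0 \<or> n = 1"
      using X by (auto simp only: fps_X_power_in_fps_ideal_iff)
    ultimately show ?thesis
      by (auto simp: fps_ideal_0)
  qed (use X in auto)
qed (rule ideal_fps_ideal)

lemma regular_local_ring_fps: "regular_local_ring fps_ring (fps_ideal 1 :: 'a::field fps set)"
proof (intro regular_local_ring.intro local_ring.intro local_ring_axioms.intro fps.noetherian_ringI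
    regular_local_ring_axioms.intro fps.cring_axioms)
  show "maximalideal (fps_ideal 1) (fps_ring :: 'a fps ring)"
    by (rule maximalideal_fps_ideal_1)
next
  fix M :: "'a fps set"
  assume M: "maximalideal M fps_ring"
  then have "M = {0} \<or> M = fps_ideal 1"
    by (intro primeideal_fps_cases fps.maximalideal_prime)
  \<comment> \<open>Both candidates for M lie in the proper ideal (X), so maximality of M forces
    equality.\<close>
  then have "M \<subseteq> fps_ideal 1"
    by (auto simp: fps_ideal_1)
  then show "M = fps_ideal 1"
    using maximalideal.I_maximal[OF M ideal_fps_ideal[of 1]]
      maximalideal.I_notcarr[OF maximalideal_fps_ideal_1, where 'a1 = 'a] by auto
next
  fix I :: "'a fps set"
  assume "ideal I fps_ring"
  then show "\<exists>A\<subseteq>carrier fps_ring. finite A \<and> I = Idl\<^bsub>fps_ring\<^esub> A"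
  proof (rule fps_ideal_cases)
    assume "I = {0}"
    then show ?thesis
      using fps.genideal_zero[where 'a = 'a] by (intro exI[of _ "{0}"]) simp
  next
    fix n assume "I = fps_ideal n"
    then show ?thesis
      by (intro exI[of _ "{fps_X ^ n}"]) (simp add: genideal_fps_X_power)
  qed
next
  show "enat (min_generators fps_ring (fps_ideal 1 :: 'a fps set)) = krull_dim (fps_ring :: 'a fps ring)"
    by (simp only: min_generators_fps_ideal krull_dim_fps_ring one_enat_def)
qed

section \<open>Primary ideals, products of ideals and reductions\<close>

lemma fps_power_in_fps_ideal:
  assumes "n > 0"
  shows "(\<exists>k. f ^ k \<in> fps_ideal n) \<longleftrightarrow> f \<in> fps_ideal 1"
proof
  assume "\<exists>k. f ^ k \<in> fps_ideal n"
  then obtain k where "fps_X ^ n dvd f ^ k"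
    by (auto simp: mem_fps_ideal)
  then have "fps_X dvd f ^ k"
    using assms by (metis dvd_power dvd_trans)
  then show "f \<in> fps_ideal 1"
    \<comment> \<open>The constant coefficient of f^k is the k-th power of that of f. The case k = 0
      is impossible because X does not divide 1.\<close>
    by (cases "k = 0") (auto simp: fps_X_dvd_iff fps_ideal_1 fps_nth_power_0)
next
  assume "f \<in> fps_ideal 1"
  then show "\<exists>k. f ^ k \<in> fps_ideal n"
    \<comment> \<open>The exponent k = n works: X divides f, so X^n divides f^n.\<close>
    by (auto simp: mem_fps_ideal intro: dvd_power_same)
qed

lemma primary_to_fps_ideal:
  assumes "n > 0"
  shows "primary_to fps_ring (fps_ideal 1) (fps_ideal n :: 'a::field fps set)"
  unfolding primary_to_def primary_ideal_def
proof (intro conjI ballI impI)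
  show "(fps_ideal n :: 'a fps set) \<noteq> carrier fps_ring"
    using assms fps_ideal_inject[of n 0] by (simp add: fps_ideal_0)
next
  fix x y :: "'a fps"
  assume "x \<otimes>\<^bsub>fps_ring\<^esub> y \<in> fps_ideal n"
  then have xy: "fps_X ^ n dvd x * y"
    by (simp add: mem_fps_ideal)
  show "x \<in> fps_ideal n \<or> (\<exists>k::nat. y [^]\<^bsub>fps_ring\<^esub> k \<in> fps_ideal n)"
  proof (cases "fps_nth y 0 = 0")
    case True
    then show ?thesis
      by (simp add: fps_power_in_fps_ideal[OF assms] fps_ideal_1)
  next
    case False
    \<comment> \<open>A series with nonzero constant coefficient is a unit, so here x and x * y are
      associates.\<close>
    then have "x * y dvd x"
      by (metis dvd_refl fps_unit_dvd mult_dvd_mono mult.right_neutral)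
    with xy show ?thesis
      by (auto simp: mem_fps_ideal intro: dvd_trans)
  qed
next
  show "ideal_radical fps_ring (fps_ideal n) = (fps_ideal 1 :: 'a fps set)"
    by (simp add: ideal_radical_def fps_power_in_fps_ideal[OF assms])
qed (rule ideal_fps_ideal)

text \<open>Orders add under multiplication and do not drop below a common bound under addition.
  Only inclusions are assumed, so that the lemma also applies to a principal ideal whose generator
  has unknown order.\<close>

lemma ideal_prod_fps_ideal_subset:
  assumes "I \<subseteq> fps_ideal m" "J \<subseteq> fps_ideal n"
  shows "I \<cdot>\<^bsub>fps_ring\<^esub> J \<subseteq> fps_ideal (m + n)"
proof
  fix f assume "f \<in> I \<cdot>\<^bsub>fps_ring\<^esub> J"
  then show "f \<in> fps_ideal (m + n)"
  proof induction
    case (prod i j)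
    then have "fps_X ^ m dvd i" "fps_X ^ n dvd j"
      using assms by (auto simp: mem_fps_ideal)
    then show ?case
      by (simp add: mem_fps_ideal power_add mult_dvd_mono)
  next
    case (sum s t)
    then show ?case
      by (simp add: mem_fps_ideal)
  qed
qed

text \<open>The exponent r = 0 works: I^0 is the whole ring, so I times I^0 is I = I^1.\<close>

lemma (in cring) is_reduction_refl:
  assumes "ideal I R"
  shows "is_reduction R I I"
proof -
  have "I \<cdot> (I [^]\<^bsub>ideals_set R\<^esub> (0::nat)) = I [^]\<^bsub>ideals_set R\<^esub> Suc 0"
    using ideal_prod_one[OF assms] ideal_prod_commute[OF assms oneideal]
    by (simp add: ideals_set_def nat_pow_def)
  then show ?thesis
    using assms unfolding is_reduction_def by blast
qed

section \<open>The family of ideals (X^(n+1)) and its joint reductions\<close>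

definition shifted_family :: "nat \<Rightarrow> 'a::field fps set" where
  "shifted_family n = fps_ideal (if n = 0 then 0 else Suc n)"

lemma graded_primary_family_shifted_family:
  "graded_primary_family fps_ring (fps_ideal 1) (shifted_family :: nat \<Rightarrow> 'a::field fps set)"
  unfolding graded_primary_family_def
proof (intro conjI allI impI)
  show "shifted_family 0 = carrier (fps_ring :: 'a fps ring)"
    by (simp add: shifted_family_def fps_ideal_0)
next
  fix n :: nat
  assume "n > 0"
  then show "primary_to fps_ring (fps_ideal 1) (shifted_family n :: 'a fps set)"
    using primary_to_fps_ideal[of "Suc n"] by (simp add: shifted_family_def)
next
  fix m n :: nat
  \<comment> \<open>The exponent function of the family, with value 0 at index 0 because the ideal
    there must be the whole ring.\<close>
  let ?d = "\<lambda>k. if k = 0 then 0 else Suc k"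
  have "shifted_family m \<cdot>\<^bsub>fps_ring\<^esub> shifted_family n \<subseteq> (fps_ideal (?d m + ?d n) :: 'a fps set)"
    by (rule ideal_prod_fps_ideal_subset) (simp_all add: shifted_family_def)
  \<comment> \<open>\<open>?d\<close> is subadditive: for positive m and n the sum of its values
    exceeds its value at m + n by exactly 1, and otherwise the two agree.\<close>
  also have "\<dots> \<subseteq> shifted_family (m + n)"
    unfolding shifted_family_def fps_ideal_def by (auto elim!: power_le_dvd)
  finally show "shifted_family m \<cdot>\<^bsub>fps_ring\<^esub> shifted_family n \<subseteq> (shifted_family (m + n) :: 'a fps set)" .
qed

text \<open>From index 1 on, X^(n+1) generates the n-th ideal, and an ideal is a reduction of
  itself. Index 0 is left out because X does not generate the whole ring.\<close>

lemma weak_asymptotic_joint_reduction_shifted_family: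
  "weak_asymptotic_joint_reduction fps_ring (shifted_family :: nat \<Rightarrow> 'a::field fps set) 1
     (\<lambda>n. fps_X ^ Suc n)"
  unfolding weak_asymptotic_joint_reduction_def
proof (intro allI impI)
  fix n :: nat
  assume "1 \<le> n"
  then have n: "shifted_family n = (fps_ideal (Suc n) :: 'a fps set)"
    by (simp add: shifted_family_def)
  show "fps_X ^ Suc n \<in> (shifted_family n :: 'a fps set) \<and>
      is_reduction fps_ring (PIdl\<^bsub>fps_ring\<^esub> (fps_X ^ Suc n)) (shifted_family n :: 'a fps set)"
    unfolding n cgenideal_fps_X_power fps_X_power_in_fps_ideal_iff
    by (intro conjI le_refl fps.is_reduction_refl ideal_fps_ideal)
qed

lemma no_strong_homogeneous_joint_reduction_shifted_family:
  fixes x :: "'a::field fps"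
  shows "\<not> strong_homogeneous_joint_reduction fps_ring shifted_family a x"
proof
  assume "strong_homogeneous_joint_reduction fps_ring shifted_family a x"
  then obtain N where "a > 0" and x: "x \<in> shifted_family a" and "N \<ge> a"
    and eq: "\<And>n. n \<ge> N \<Longrightarrow>
      shifted_family n = (PIdl\<^bsub>fps_ring\<^esub> x) \<cdot>\<^bsub>fps_ring\<^esub> shifted_family (n - a)"
    unfolding strong_homogeneous_joint_reduction_def by blast
  \<comment> \<open>N itself might equal a, and then the second factor would be the whole ring, with
    no extra power of X. Taking \<open>Suc N\<close> makes \<open>?n - a\<close> positive.\<close>
  let ?n = "Suc N"
  have "PIdl\<^bsub>fps_ring\<^esub> x \<subseteq> fps_ideal (Suc a)"
    using \<open>a > 0\<close> x by (intro fps.cgenideal_minimal ideal_fps_ideal) (simp add: shifted_family_def)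
  moreover have "shifted_family (?n - a) \<subseteq> (fps_ideal (Suc (?n - a)) :: 'a fps set)"
    using \<open>N \<ge> a\<close> by (simp add: shifted_family_def)
  ultimately have "shifted_family ?n \<subseteq> (fps_ideal (Suc a + Suc (?n - a)) :: 'a fps set)"
    unfolding eq[of ?n, OF le_SucI[OF le_refl]] by (rule ideal_prod_fps_ideal_subset)
  moreover have "(fps_X :: 'a fps) ^ Suc ?n \<in> shifted_family ?n"
    by (simp only: shifted_family_def fps_X_power_in_fps_ideal_iff) simp
  ultimately have "(fps_X :: 'a fps) ^ Suc ?n \<in> fps_ideal (Suc a + Suc (?n - a))"
    by blast
  \<comment> \<open>Each factor contributes its own shift by 1, so the left side equals N + 3, while
    the right side is N + 2.\<close>
  then have "Suc a + Suc (?n - a) \<le> Suc ?n"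
    by (simp only: fps_X_power_in_fps_ideal_iff)
  with \<open>N \<ge> a\<close> show False
    by simp
qed

theorem proposition4p17:
  shows "\<exists>(R :: witness ring) (\<mm> :: witness set) (I :: nat \<Rightarrow> witness set).
           regular_local_ring R \<mm> \<and> krull_dim R = 1 \<and>
           graded_primary_family R \<mm> I \<and>
           (\<exists>n\<^sub>0 x. weak_asymptotic_joint_reduction R I n\<^sub>0 x) \<and>
           \<not> (\<exists>a x. strong_homogeneous_joint_reduction R I a x)"
proof (intro exI conjI)
  show "regular_local_ring fps_ring (fps_ideal 1 :: witness set)"
    by (rule regular_local_ring_fps)
  show "krull_dim (fps_ring :: witness ring) = 1"
    by (rule krull_dim_fps_ring)
  show "graded_primary_family fps_ring (fps_ideal 1) (shifted_family :: nat \<Rightarrow> witness set)"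
    by (rule graded_primary_family_shifted_family)
  show "weak_asymptotic_joint_reduction fps_ring (shifted_family :: nat \<Rightarrow> witness set) 1
      (\<lambda>n. fps_X ^ Suc n)"
    by (rule weak_asymptotic_joint_reduction_shifted_family)
  show "\<not> (\<exists>a x. strong_homogeneous_joint_reduction fps_ring
      (shifted_family :: nat \<Rightarrow> witness set) a x)"
    by (simp add: no_strong_homogeneous_joint_reduction_shifted_family)
qed

end
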